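(* There is an absolute constant $C>0$ such that for every integer $n\ge1$ and all reals $0<\varepsilon<1$, $0<\delta<1$ there exists a mergeable cardinality estimation data structure for the universe $[n]$ with relative accuracy $\varepsilon$ and failure probability $\delta$ whose space usage is at most $C\,(\ln(\delta^{-1})\varepsilon^{-2}+\ln n+1)$ bits.
   Context: $[n]:=\{0,\dots,n-1\}$. A mergeable cardinality estimation data structure for $[n]$ with relative accuracy $\varepsilon$ and failure probability $\delta$ consists of: a finite nonempty seed set $\Theta$ (seeds drawn uniformly at random), a set $S$ of sketches together with an injective encoding of sketches as finite bit strings, functions $\mathrm{single}:[n]\times\Theta\to S$, $\mathrm{merge}:S\times S\to S$, $\mathrm{estimate}:S\to\mathbb R$, and a map $\nu$ assigning to each $\theta\in\Theta$ and nonempty $A\subseteq[n]$ a sketch $\nu(\theta,A)\in S$, such that for all $\theta$, $x\in[n]$ and nonempty $A,B\subseteq[n]$: $\mathrm{single}(x,\theta)=\nu(\theta,\{x\})$ and $\mathrm{merge}(\nu(\theta,A),\nu(\theta,B))=\nu(\theta,A\cup B)$; and for every nonempty $A\subseteq[n]$, $\Pr_{\theta\sim U(\Theta)}\big(|\mathrm{estimate}(\nu(\theta,A))-|A||>\varepsilon|A|\big)\le\delta$. Its space usage is $\lceil\log_2|\Theta|\rceil$ plus the maximum, over all $\theta\in\Theta$ and nonempty $A\subseteq[n]$, of the bit length of the encoding of $\nu(\theta,A)$. *)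

theory Defs
  imports Complex_Main
begin

text \<open>Universe [n] = {..<n}. Seeds of type 'th, sketches of type 'sk,
  enc is the encoding of sketches as bit strings (injective on S).\<close>

definition nonempty_sub :: "nat \<Rightarrow> nat set \<Rightarrow> bool" where
  "nonempty_sub n A \<longleftrightarrow> A \<noteq> {} \<and> A \<subseteq> {..<n}"

definition mergeable_ce ::
  "nat \<Rightarrow> real \<Rightarrow> real \<Rightarrow> 'th set \<Rightarrow> 'sk set \<Rightarrow> ('sk \<Rightarrow> bool list)
   \<Rightarrow> (nat \<Rightarrow> 'th \<Rightarrow> 'sk) \<Rightarrow> ('sk \<Rightarrow> 'sk \<Rightarrow> 'sk) \<Rightarrow> ('sk \<Rightarrow> real)
   \<Rightarrow> ('th \<Rightarrow> nat set \<Rightarrow> 'sk) \<Rightarrow> bool" where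
  "mergeable_ce n \<epsilon> \<delta> \<Theta> S enc single merge estimate \<nu> \<longleftrightarrow>
     finite \<Theta> \<and> \<Theta> \<noteq> {} \<and> inj_on enc S \<and>
     (\<forall>x<n. \<forall>\<theta>\<in>\<Theta>. single x \<theta> \<in> S) \<and>
     (\<forall>s\<in>S. \<forall>t\<in>S. merge s t \<in> S) \<and>
     (\<forall>\<theta>\<in>\<Theta>. \<forall>A. nonempty_sub n A \<longrightarrow> \<nu> \<theta> A \<in> S) \<and>
     (\<forall>\<theta>\<in>\<Theta>. \<forall>x<n. single x \<theta> = \<nu> \<theta> {x}) \<and>
     (\<forall>\<theta>\<in>\<Theta>. \<forall>A B. nonempty_sub n A \<and> nonempty_sub n B \<longrightarrow>
         merge (\<nu> \<theta> A) (\<nu> \<theta> B) = \<nu> \<theta> (A \<union> B)) \<and>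
     (\<forall>A. nonempty_sub n A \<longrightarrow>
         real (card {\<theta>\<in>\<Theta>. \<bar>estimate (\<nu> \<theta> A) - real (card A)\<bar> > \<epsilon> * real (card A)})
           / real (card \<Theta>) \<le> \<delta>)"

definition space_usage ::
  "nat \<Rightarrow> 'th set \<Rightarrow> ('sk \<Rightarrow> bool list) \<Rightarrow> ('th \<Rightarrow> nat set \<Rightarrow> 'sk) \<Rightarrow> real" where
  "space_usage n \<Theta> enc \<nu> =
     real_of_int \<lceil>log 2 (real (card \<Theta>))\<rceil> +
     real (Max {length (enc (\<nu> \<theta> A)) | \<theta> A. \<theta> \<in> \<Theta> \<and> nonempty_sub n A})"

end

theory Submission
  imports Defs "HOL-Probability.Probability"
begin

text \<open>
  Since only existence is claimed, no explicit hash families are needed. Give every element of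
  \<open>[n]\<close> an independent geometric level in each of \<open>b\<close> independent rows, and let \<open>M\<^sub>i\<close> be the
  maximal level of \<open>A\<close> in row \<open>i\<close>. The fraction of rows with \<open>M\<^sub>i \<ge> s\<close> concentrates around
  \<open>1 - (1 - 2\<^bsup>-s\<^esup>)\<^bsup>|A|\<^esup>\<close>, which determines \<open>|A|\<close> well when \<open>2\<^bsup>s\<^esup>\<close> is of order \<open>|A|\<close>. The sketch stores,
  in unary, the least cutoff \<open>q\<close> with \<open>\<Sum>\<^sub>i (M\<^sub>i - q)\<^sup>+ \<le> 6b\<close> together with the truncated differences;
  as \<open>q\<close> is monotone in \<open>A\<close>, sketches can be merged, and their size is \<open>O(b + log n)\<close> in the
  worst case. A random sample of \<open>O(n/\<delta>\<^sup>2)\<close> seeds works simultaneously for all \<open>2\<^sup>n\<close> sets by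
  Hoeffding's inequality and a union bound.

  If \<open>\<delta>\<close> is close to \<open>1\<close>, the budget \<open>ln(1/\<delta>)/\<epsilon>\<^sup>2\<close> is too small for accuracy \<open>\<epsilon>\<close> with constant
  probability. Then the rows only guarantee accuracy of order \<open>L\<epsilon>\<close>, and the seed contains a random
  guess \<open>u < L\<close> of the position inside that confidence interval, which is right with probability
  \<open>1/L\<close>; \<open>L\<close> of order \<open>min((1-\<delta>)\<^bsup>-1/2\<^esup>, 1/\<epsilon>)\<close> balances both requirements.
\<close>

section \<open>Hitting probabilities\<close>

text \<open>Levels are capped at \<open>N\<close>, which bounds the unary encoding of the cutoff in the worst case.\<close>

definition row_max :: "nat \<Rightarrow> (nat \<Rightarrow> nat) \<Rightarrow> nat set \<Rightarrow> nat" where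
  "row_max N h A = Max ((\<lambda>x. min N (h x)) ` A)"

text \<open>The probability that one of \<open>a\<close> independent geometric levels reaches
  \<open>s\<close>.\<close>

definition hit_prob :: "nat \<Rightarrow> nat \<Rightarrow> real" where
  "hit_prob s a = 1 - (1 - (1/2) ^ s) ^ a"

text \<open>The bit length of \<open>a\<close>. For \<open>a \<ge> 1\<close> the ratio
  \<open>a / 2^(lev a)\<close> lies in [1/2, 1), so \<open>lev a\<close> is a level that a constant
  fraction of the rows reaches.\<close>

definition lev :: "nat \<Rightarrow> nat" where
  "lev a = (LEAST s. a < 2 ^ s)"

lemma less_two_power_lev: "a < 2 ^ lev a"
  unfolding lev_def by (rule LeastI[of _ a]) (rule less_exp)

lemma two_power_le_of_lev:
  assumes "a \<ge> 1"
  shows "lev a \<ge> 1" "2 ^ (lev a - 1) \<le> a"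
proof -
  show *: "lev a \<ge> 1" using less_two_power_lev[of a] assms by (cases "lev a") auto
  have "\<not> a < 2 ^ (lev a - 1)"
    unfolding lev_def by (rule not_less_Least) (use * in \<open>auto simp: lev_def\<close>)
  thus "2 ^ (lev a - 1) \<le> a" by simp
qed

lemma lev_mono: "a \<le> c \<Longrightarrow> lev a \<le> lev c"
  unfolding lev_def[of a] by (rule Least_le) (use less_two_power_lev[of c] in linarith)

text \<open>Multiplying by \<open>1 + a y \<le> (1 + y)^a\<close> gives at most
  \<open>(1 - y^2)^a \<le> 1\<close>. Unlike the bound \<open>exp (- a y)\<close>, this rational
  bound can be solved for \<open>a y\<close> by linear algebra.\<close>

lemma miss_prob_le: "(1 - (1/2) ^ t) ^ a \<le> 1 / (1 + real a * (1/2) ^ t)"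
proof -
  let ?y = "(1/2::real) ^ t"
  have y: "0 < ?y" "?y \<le> 1" by (auto simp: power_le_one)
  have "(1 - ?y) ^ a * (1 + real a * ?y) \<le> (1 - ?y) ^ a * (1 + ?y) ^ a"
  proof (intro mult_left_mono)
    have "-1 \<le> ?y" using y by linarith
    thus "1 + real a * ?y \<le> (1 + ?y) ^ a" by (rule Bernoulli_inequality)
  qed (use y in auto)
  also have "\<dots> = (1 - ?y * ?y) ^ a" by (simp add: power_mult_distrib[symmetric] algebra_simps)
  also have "\<dots> \<le> 1" using y by (intro power_le_one) (auto simp: mult_le_one)
  finally show ?thesis using y by (intro mult_imp_le_div_pos) (auto simp: add_pos_nonneg)
qed

text \<open>The sequence \<open>(1 - 2^(-t))^(2^t)\<close> increases in \<open>t\<close>, because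
  \<open>1 - y \<le> (1 - y/2)^2\<close>; its value at \<open>t = 1\<close> is 1/4.\<close>

lemma miss_prob_ge:
  assumes "t \<ge> 1" "a \<le> 2 ^ t"
  shows "(1 - (1/2) ^ t) ^ a \<ge> (1/4::real)"
proof -
  have "(1 - (1/2) ^ t) ^ (2 ^ t) \<ge> (1/4::real)" using assms(1)
  proof (induction t rule: dec_induct)
    case base show ?case by (simp add: power2_eq_square)
  next
    case (step t)
    let ?y = "(1/2::real) ^ t"
    have "1/4 \<le> (1 - ?y) ^ (2 ^ t)" by fact
    also have "\<dots> \<le> ((1 - ?y / 2)\<^sup>2) ^ (2 ^ t)"
      by (intro power_mono) (auto simp: power2_eq_square algebra_simps power_le_one)
    also have "\<dots> = (1 - (1/2) ^ Suc t) ^ (2 ^ Suc t)"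
      by (simp add: power_mult[symmetric])
    finally show ?case .
  qed
  also have "\<dots> \<le> (1 - (1/2) ^ t) ^ a"
    using assms(2) by (intro power_decreasing) (auto simp: power_le_one)
  finally show ?thesis .
qed

lemma hit_prob_le: "hit_prob s a \<le> real a * (1/2) ^ s"
  using Bernoulli_inequality[of "- ((1/2::real) ^ s)" a] by (simp add: hit_prob_def power_le_one)

lemma hit_prob_lev:
  assumes "a \<ge> 1"
  shows "1/3 \<le> hit_prob (lev a) a" "hit_prob (lev a) a \<le> 3/4"
proof -
  note l = two_power_le_of_lev[OF assms] less_two_power_lev[of a]
  show "hit_prob (lev a) a \<le> 3/4"
    using miss_prob_ge[of "lev a" a] l by (simp add: hit_prob_def)
  have "real (2 ^ (lev a - 1)) \<le> real a" using l by (simp only: of_nat_le_iff)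
  moreover have "(2::real) ^ lev a = 2 * 2 ^ (lev a - 1)"
    using l(1) by (simp flip: power_Suc)
  ultimately have "1/2 \<le> real a * (1/2) ^ lev a"
    by (simp add: power_one_over field_simps)
  hence "1 / (1 + real a * (1/2) ^ lev a) \<le> 1 / (3/2)" by (intro divide_left_mono) auto
  with miss_prob_le[of "lev a" a] show "1/3 \<le> hit_prob (lev a) a"
    by (simp add: hit_prob_def)
qed

text \<open>On average at least 2 elements reach level \<open>s\<close>, so all miss it with
  probability at most \<open>exp (-2) \<le> 1/5\<close>.\<close>

lemma hit_prob_two_below:
  assumes "2 * 2 ^ s \<le> a"
  shows "hit_prob s a \<ge> 4/5"
proof -
  let ?y = "(1/2::real) ^ s"
  have "real (2 * 2 ^ s) \<le> real a" using assms by (simp only: of_nat_le_iff)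
  hence a: "2 \<le> real a * ?y" by (simp add: power_one_over field_simps)
  have "(1 - ?y) ^ a \<le> exp (- ?y) ^ a"
    using exp_ge_add_one_self[of "- ?y"] by (intro power_mono) (auto simp: power_le_one)
  also have "\<dots> = exp (- (real a * ?y))" by (simp add: exp_of_nat_mult[symmetric])
  also have "\<dots> \<le> exp (-2)" using a by simp
  also have "\<dots> \<le> 1/5"
    using exp_lower_Taylor_quadratic[of 2] by (simp add: exp_minus field_simps)
  finally show ?thesis by (simp add: hit_prob_def)
qed

text \<open>For \<open>l = min a c\<close> and \<open>l + d = max a c\<close> the two probabilities
  differ by \<open>r^l * (1 - r^d)\<close>, where \<open>r^l \<ge> 1/4\<close> as
  \<open>l \<le> c < 2^t\<close>. Hence \<open>1 - r^d \<le> 8 \<tau>\<close>, which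
  \<open>miss_prob_le\<close> turns into \<open>d / 2^t \<le> 16 \<tau>\<close>, and
  \<open>2^t \<le> 2 c\<close>.\<close>

lemma hit_prob_close_imp_close:
  assumes "\<bar>hit_prob (lev c) a - hit_prob (lev c) c\<bar> \<le> 2 * \<tau>" "c \<ge> 1" "\<tau> \<le> 1/64"
  shows "\<bar>real a - real c\<bar> \<le> 32 * \<tau> * real c"
proof -
  define t where "t = lev c"
  define r where "r = 1 - (1/2::real) ^ t"
  define l where "l = min a c"
  define d where "d = max a c - l"
  note lc = two_power_le_of_lev[OF assms(2)] less_two_power_lev[of c]
  have r: "0 \<le> r" "r \<le> 1" by (auto simp: r_def power_le_one)
  have "1/4 \<le> r ^ c" unfolding r_def t_def using lc by (intro miss_prob_ge) auto
  also have "\<dots> \<le> r ^ l" using r by (intro power_decreasing) (auto simp: l_def)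
  finally have rl: "1/4 \<le> r ^ l" .
  have "r ^ l - r ^ (l + d) \<le> 2 * \<tau>"
    using assms(1) by (auto simp: hit_prob_def r_def t_def l_def d_def min_def max_def split: if_splits)
  hence "r ^ l * (1 - r ^ d) \<le> 2 * \<tau>" by (simp add: power_add algebra_simps)
  moreover have "1/4 * (1 - r ^ d) \<le> r ^ l * (1 - r ^ d)"
    using rl r by (intro mult_right_mono) (auto simp: power_le_one)
  ultimately have 1: "1 - r ^ d \<le> 8 * \<tau>" by (simp add: field_simps)
  let ?y = "real d * (1/2) ^ t"
  have "1 - 8 * \<tau> \<le> 1 / (1 + ?y)" using 1 miss_prob_le[of t d] by (simp add: r_def)
  moreover have "0 < 1 + ?y" by (simp add: add_pos_nonneg)
  ultimately have "(1 - 8 * \<tau>) * (1 + ?y) \<le> 1" by (simp only: pos_le_divide_eq)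
  hence "?y * (1 - 8 * \<tau>) \<le> 8 * \<tau>" by (simp add: algebra_simps)
  moreover have "?y * (7/8) \<le> ?y * (1 - 8 * \<tau>)" using assms(3) by (intro mult_left_mono) auto
  moreover have tau: "0 \<le> \<tau>" using assms(1) by linarith
  ultimately have y: "?y \<le> 16 * \<tau>" by linarith
  have "real d = ?y * 2 ^ t" by (simp add: power_one_over)
  also have "\<dots> \<le> 16 * \<tau> * 2 ^ t" using y by (intro mult_right_mono) auto
  also have "(2::real) ^ t = 2 * real (2 ^ (t - 1))" using lc(1) by (simp add: t_def flip: power_Suc)
  also have "16 * \<tau> * \<dots> \<le> 16 * \<tau> * (2 * real c)"
    using lc(2) tau by (intro mult_left_mono) (auto simp: t_def simp del: of_nat_power)
  finally have "real d \<le> 32 * \<tau> * real c" by simp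
  moreover have "real d = \<bar>real a - real c\<bar>" by (auto simp: d_def l_def min_def max_def of_nat_diff)
  ultimately show ?thesis by simp
qed

section \<open>Random rows\<close>

lemma prob_geometric_lessThan:
  "measure_pmf.prob (geometric_pmf (1/2)) {..<s} = 1 - (1/2) ^ s"
proof -
  have "measure_pmf.prob (geometric_pmf (1/2)) {..<s} = (\<Sum>i<s. (1/2) ^ i * (1/2))"
    by (subst measure_measure_pmf_finite) (auto intro!: sum.cong)
  also have "\<dots> = 1 - (1/2) ^ s" by (induction s) auto
  finally show ?thesis .
qed

definition row_pmf :: "nat \<Rightarrow> (nat \<Rightarrow> nat) pmf" where
  "row_pmf n = Pi_pmf {..<n} 0 (\<lambda>_. geometric_pmf (1/2))"

lemma row_max_ge_iff:
  assumes "finite A" "A \<noteq> {}" "s \<le> N"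
  shows "s \<le> row_max N h A \<longleftrightarrow> (\<exists>x\<in>A. s \<le> h x)"
  unfolding row_max_def using assms by (subst Max_ge_iff) auto

lemma row_max_le: "finite A \<Longrightarrow> A \<noteq> {} \<Longrightarrow> row_max N h A \<le> N"
  by (auto simp: row_max_def)

lemma row_max_Un:
  assumes "finite A" "A \<noteq> {}" "finite B" "B \<noteq> {}"
  shows "row_max N h (A \<union> B) = max (row_max N h A) (row_max N h B)"
  unfolding row_max_def image_Un using assms by (intro Max_Un) auto

text \<open>The complement is a product event: each element of \<open>A\<close> independently stays
  below \<open>s\<close>. For \<open>s \<le> N\<close> the cap does not affect it.\<close>

lemma prob_row_max_ge:
  assumes "A \<subseteq> {..<n}" "A \<noteq> {}" "s \<le> N"
  shows "measure_pmf.prob (row_pmf n) {h. s \<le> row_max N h A} = hit_prob s (card A)"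
proof -
  have fin: "finite A" using assms(1) finite_subset by blast
  let ?B = "\<lambda>x. if x \<in> A then {..<s} else UNIV"
  have "{h. s \<le> row_max N h A} = UNIV - Pi {..<n} ?B"
  proof (rule set_eqI)
    fix h
    have "h \<in> Pi {..<n} ?B \<longleftrightarrow> (\<forall>x\<in>A. h x < s)" using assms(1) by (auto simp: Pi_def)
    thus "h \<in> {h. s \<le> row_max N h A} \<longleftrightarrow> h \<in> UNIV - Pi {..<n} ?B"
      using row_max_ge_iff[OF fin assms(2,3), of h] by (auto simp: not_less)
  qed
  also have "measure_pmf.prob (row_pmf n) \<dots> = 1 - measure_pmf.prob (row_pmf n) (Pi {..<n} ?B)"
    by (subst measure_pmf.prob_compl[symmetric]) auto
  also have "measure_pmf.prob (row_pmf n) (Pi {..<n} ?B)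
      = (\<Prod>x<n. measure_pmf.prob (geometric_pmf (1/2)) (?B x))"
    unfolding row_pmf_def by (rule measure_Pi_pmf_Pi) simp
  also have "\<dots> = (\<Prod>x<n. if x \<in> A then 1 - (1/2) ^ s else 1)"
    by (intro prod.cong) (auto simp: prob_geometric_lessThan)
  also have "\<dots> = (\<Prod>x\<in>{..<n} \<inter> A. 1 - (1/2) ^ s)"
    by (subst prod.inter_restrict) auto
  also have "{..<n} \<inter> A = A" using assms by auto
  finally show ?thesis by (simp add: hit_prob_def)
qed

section \<open>Hoeffding bounds for counts of independent samples\<close>

lemma map_pmf_bernoulli:
  "map_pmf Q p = bernoulli_pmf (measure_pmf.prob p {x. Q x})"
proof (rule pmf_eqI)
  fix b
  have "pmf (map_pmf Q p) b = measure_pmf.prob p (if b then {x. Q x} else UNIV - {x. Q x})"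
    by (cases b) (auto simp: pmf_map vimage_def intro!: arg_cong[of _ _ "measure_pmf.prob p"])
  also have "\<dots> = pmf (bernoulli_pmf (measure_pmf.prob p {x. Q x})) b"
    using measure_pmf.prob_compl[of "{x. Q x}" p] by (cases b) auto
  finally show "pmf (map_pmf Q p) b = pmf (bernoulli_pmf (measure_pmf.prob p {x. Q x})) b" .
qed

lemma map_card_Pi_pmf:
  "map_pmf (\<lambda>f. card {i\<in>{..<k::nat}. Q (f i)}) (Pi_pmf {..<k} d (\<lambda>_. p))
     = binomial_pmf k (measure_pmf.prob p {x. Q x})"
proof -
  have "binomial_pmf k (measure_pmf.prob p {x. Q x})
      = map_pmf (\<lambda>f. card {i\<in>{..<k}. f i}) (Pi_pmf {..<k} (Q d) (\<lambda>_. map_pmf Q p))"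
    unfolding map_pmf_bernoulli by (intro binomial_pmf_altdef') auto
  also have "Pi_pmf {..<k} (Q d) (\<lambda>_. map_pmf Q p) = map_pmf (\<lambda>h. Q \<circ> h) (Pi_pmf {..<k} d (\<lambda>_. p))"
    by (rule Pi_pmf_map) auto
  finally show ?thesis by (simp add: pmf.map_comp o_def)
qed

lemma Pi_pmf_count_deviation:
  fixes k :: nat
  assumes "k > 0" "\<tau> \<ge> 0"
  shows "measure_pmf.prob (Pi_pmf {..<k} d (\<lambda>_. p))
     {f. \<bar>real (card {i\<in>{..<k}. Q (f i)}) / real k - measure_pmf.prob p {x. Q x}\<bar> \<ge> \<tau>}
     \<le> 2 * exp (-2 * real k * \<tau>\<^sup>2)"
proof -
  interpret binomial_distribution k "measure_pmf.prob p {x. Q x}" by unfold_locales auto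
  show ?thesis
    using prob_abs_ge'[OF assms] unfolding map_card_Pi_pmf[symmetric, where k = k and Q = Q and d = d and p = p]
    by (simp add: vimage_def)
qed

lemma Pi_pmf_count_excess:
  fixes k :: nat
  assumes "k > 0" "g \<ge> 0" "measure_pmf.prob p {x. Q x} + g \<le> \<delta>"
  shows "measure_pmf.prob (Pi_pmf {..<k} d (\<lambda>_. p))
     {f. real (card {i\<in>{..<k}. Q (f i)}) > \<delta> * real k} \<le> exp (-2 * real k * g\<^sup>2)"
proof -
  interpret binomial_distribution k "measure_pmf.prob p {x. Q x}" by unfold_locales auto
  let ?M = "Pi_pmf {..<k} d (\<lambda>_. p)"
  have "measure_pmf.prob ?M {f. real (card {i\<in>{..<k}. Q (f i)}) > \<delta> * real k}
     \<le> measure_pmf.prob ?M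
         {f. real (card {i\<in>{..<k}. Q (f i)}) / real k \<ge> measure_pmf.prob p {x. Q x} + g}"
  proof (intro measure_pmf.finite_measure_mono Collect_mono impI)
    fix f assume f: "\<delta> * real k < real (card {i\<in>{..<k}. Q (f i)})"
    have "(measure_pmf.prob p {x. Q x} + g) * real k \<le> \<delta> * real k"
      using assms by (intro mult_right_mono) auto
    thus "measure_pmf.prob p {x. Q x} + g \<le> real (card {i\<in>{..<k}. Q (f i)}) / real k"
      using order.strict_implies_order[OF order.strict_trans1[OF _ f]] assms(1)
      by (intro mult_imp_le_div_pos) auto
  qed auto
  also have "\<dots> \<le> exp (-2 * real k * g\<^sup>2)"
    using prob_ge'[OF assms(1,2)] unfolding map_card_Pi_pmf[symmetric, where k = k and Q = Q and d = d and p = p]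
    by (simp add: vimage_def)
  finally show ?thesis .
qed

text \<open>The excess over \<open>lev (card A) - 1\<close> is larger than \<open>j\<close> with
  probability at most \<open>2^(-j)\<close>, so the increments of \<open>(3/2)^j\<close> contribute
  a geometric series of ratio 3/4 with sum at most 2.\<close>

lemma expectation_power_row_max:
  assumes "A \<subseteq> {..<n}" "A \<noteq> {}"
  shows "measure_pmf.expectation (row_pmf n) (\<lambda>h. (3/2::real) ^ (row_max N h A - (lev (card A) - 1))) \<le> 3"
proof -
  let ?k = "lev (card A) - 1"
  have fin: "finite A" using assms(1) finite_subset by blast
  have a: "card A \<ge> 1" using fin assms(2) by (simp add: card_gt_0_iff Suc_le_eq)
  \<comment> \<open>\<open>(3/2)^j / 2\<close> is the increment from \<open>(3/2)^j\<close> to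
    \<open>(3/2)^(j + 1)\<close>. The range \<open>J\<close> is independent of the random
    \<open>X\<close>, so expectation and sum can be exchanged.\<close>
  have telescope: "(3/2::real) ^ X = 1 + (\<Sum>j<J. (3/2) ^ j / 2 * of_bool (j < X))"
    if "X \<le> J" for X J :: nat
  proof -
    have "(\<Sum>j<J. (3/2::real) ^ j / 2 * of_bool (j < X)) = (\<Sum>j\<in>{..<J} \<inter> {..<X}. (3/2) ^ j / 2)"
      by (subst sum.inter_restrict) (auto intro!: sum.cong)
    also have "{..<J} \<inter> {..<X} = {..<X}" using that by auto
    also have "1 + (\<Sum>j<X. (3/2::real) ^ j / 2) = (3/2) ^ X" by (induction X) auto
    finally show ?thesis by simp
  qed
  have "measure_pmf.expectation (row_pmf n) (\<lambda>h. (3/2::real) ^ (row_max N h A - ?k))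
     = measure_pmf.expectation (row_pmf n)
         (\<lambda>h. 1 + (\<Sum>j<N - ?k. (3/2) ^ j / 2 * indicator {h. Suc (j + ?k) \<le> row_max N h A} h))"
    using row_max_le[OF fin assms(2), of N]
    by (intro Bochner_Integration.integral_cong refl, subst telescope[where J = "N - ?k"])
       (auto intro!: sum.cong simp: indicator_def diff_le_mono)
  also have "\<dots> = 1 + (\<Sum>j<N - ?k. (3/2) ^ j / 2 * measure_pmf.prob (row_pmf n) {h. Suc (j + ?k) \<le> row_max N h A})"
  proof -
    have int: "integrable (row_pmf n) (\<lambda>h. (3/2) ^ j / 2 *
        indicat_real {h. Suc (j + ?k) \<le> row_max N h A} h)" for j
      by (intro integrable_mult_right) (auto intro!: measure_pmf.integrable_const_bound[of _ 1])
    show ?thesis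
      using int by (subst Bochner_Integration.integral_add)
        (auto simp: Bochner_Integration.integral_sum simp del: One_nat_def
           intro!: Bochner_Integration.integrable_sum sum.cong)
  qed
  also have "\<dots> \<le> 1 + (\<Sum>j<N - ?k. (3/4) ^ j / 2)"
  proof (intro add_left_mono sum_mono)
    fix j assume j: "j \<in> {..<N - ?k}"
    have "measure_pmf.prob (row_pmf n) {h. Suc (j + ?k) \<le> row_max N h A} = hit_prob (Suc (j + ?k)) (card A)"
      by (rule prob_row_max_ge) (use assms j in auto)
    also have "\<dots> \<le> real (card A) * (1/2) ^ Suc (j + ?k)" by (rule hit_prob_le)
    also have "\<dots> \<le> 2 ^ lev (card A) * (1/2) ^ Suc (j + ?k)"
      using less_two_power_lev[of "card A"]
      by (intro mult_right_mono) (auto simp flip: of_nat_less_iff intro: less_imp_le simp del: of_nat_less_iff)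
    also have "(2::real) ^ lev (card A) = 2 * 2 ^ ?k"
      using two_power_le_of_lev(1)[OF a] by (simp flip: power_Suc)
    also have "2 * 2 ^ ?k * (1/2) ^ Suc (j + ?k) = (1/2::real) ^ j"
      by (simp add: power_add power_one_over)
    finally have "(3/2) ^ j / 2 * measure_pmf.prob (row_pmf n) {h. Suc (j + ?k) \<le> row_max N h A}
       \<le> (3/2) ^ j / 2 * (1/2) ^ j" by (intro mult_left_mono) auto
    also have "\<dots> = (3/4) ^ j / 2" by (simp add: power_mult_distrib[symmetric])
    finally show "(3/2) ^ j / 2 * measure_pmf.prob (row_pmf n) {h. Suc (j + ?k) \<le> row_max N h A} \<le> (3/4) ^ j / 2" .
  qed
  also have "(\<Sum>j<N - ?k. (3/4::real) ^ j / 2) = 2 - 2 * (3/4) ^ (N - ?k)"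
    by (induction "N - ?k") (simp_all add: sum_divide_distrib[symmetric] geometric_sum)
  also have "1 + \<dots> \<le> 3" by simp
  finally show ?thesis by simp
qed

definition rows_pmf :: "nat \<Rightarrow> nat \<Rightarrow> (nat \<Rightarrow> nat \<Rightarrow> nat) pmf" where
  "rows_pmf n b = Pi_pmf {..<b} (\<lambda>_. 0) (\<lambda>_. row_pmf n)"

text \<open>A Chernoff bound: by independence the product of the \<open>(3/2)^excess\<close> has
  mean at most \<open>3^b\<close>, and Markov's inequality at \<open>(3/2)^(6 b)\<close> leaves
  \<open>(3 / (3/2)^6)^b\<close>. The 6 makes this base at most
  \<open>1/3 \<le> exp (-1)\<close>.\<close>

lemma prob_total_excess:
  assumes "A \<subseteq> {..<n}" "A \<noteq> {}"
  shows "measure_pmf.prob (rows_pmf n b)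
     {H. (\<Sum>i<b. row_max N (H i) A - (lev (card A) - 1)) > 6 * b} \<le> exp (- real b)"
proof -
  let ?k = "lev (card A) - 1"
  let ?f = "\<lambda>h. (3/2::real) ^ (row_max N h A - ?k)"
  have fin: "finite A" using assms(1) finite_subset by blast
  have bnd: "?f h \<le> (3/2) ^ N" for h
    using row_max_le[OF fin assms(2), of N h] by (intro power_increasing) auto
  have int: "integrable (row_pmf n) ?f"
    using bnd by (intro measure_pmf.integrable_const_bound[of _ "(3/2) ^ N"]) auto
  have int': "integrable (rows_pmf n b) (\<lambda>H. \<Prod>i<b. ?f (H i))"
  proof (rule measure_pmf.integrable_const_bound[of _ "\<Prod>i<b. (3/2) ^ N"])
    show "AE H in measure_pmf (rows_pmf n b). norm (\<Prod>i<b. ?f (H i)) \<le> (\<Prod>i<b. (3/2) ^ N)"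
      using bnd by (intro AE_I2) (auto simp: abs_prod simp del: prod_constant intro!: prod_mono)
  qed auto
  have "measure_pmf.prob (rows_pmf n b) {H. (\<Sum>i<b. row_max N (H i) A - ?k) > 6 * b}
      \<le> measure_pmf.prob (rows_pmf n b) {H\<in>space (rows_pmf n b). (\<Prod>i<b. ?f (H i)) \<ge> (3/2) ^ (6 * b)}"
    by (intro measure_pmf.finite_measure_mono)
       (auto simp: power_sum[symmetric] simp del: power_mult intro!: power_increasing)
  also have "\<dots> \<le> measure_pmf.expectation (rows_pmf n b) (\<lambda>H. \<Prod>i<b. ?f (H i)) / (3/2) ^ (6 * b)"
    by (rule integral_Markov_inequality_measure[where A = UNIV]) (use int' in \<open>auto intro!: AE_I2 prod_nonneg\<close>)
  also have "measure_pmf.expectation (rows_pmf n b) (\<lambda>H. \<Prod>i<b. ?f (H i))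
     = (\<Prod>i<b. measure_pmf.expectation (row_pmf n) ?f)"
    unfolding rows_pmf_def by (rule expectation_prod_Pi_pmf) (use int in auto)
  also have "\<dots> \<le> (\<Prod>i<b. 3)"
    using expectation_power_row_max[OF assms, of N] by (intro prod_mono) (auto intro: Bochner_Integration.integral_nonneg)
  also have "(\<Prod>i<b. 3) / (3/2) ^ (6 * b) = (3 / (3/2) ^ 6 :: real) ^ b"
    by (simp only: prod_constant card_lessThan power_mult power_divide[symmetric])
  also have "\<dots> \<le> exp (-1) ^ b"
  proof (intro power_mono)
    have "3 / (3/2) ^ 6 \<le> 1 / (3::real)" by (simp add: power_divide)
    also have "\<dots> \<le> 1 / exp 1" using exp_le by (intro divide_left_mono) auto
    finally show "3 / (3/2) ^ 6 \<le> exp (- (1::real))" by (simp add: exp_minus field_simps)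
  qed auto
  also have "\<dots> = exp (- real b)" by (simp add: exp_of_nat_mult[symmetric])
  finally show ?thesis by (simp add: divide_right_mono)
qed

section \<open>The sketch and its estimate\<close>

definition hit_rate :: "nat \<Rightarrow> (nat \<Rightarrow> nat) \<Rightarrow> nat \<Rightarrow> real" where
  "hit_rate b w t = real (card {i\<in>{..<b}. t \<le> w i}) / real b"

text \<open>The second condition puts the cutoff at most at \<open>lev a - 1\<close>, so the sketch
  still shows which rows reach \<open>lev a\<close>.\<close>

definition typical :: "nat \<Rightarrow> real \<Rightarrow> nat \<Rightarrow> (nat \<Rightarrow> nat) \<Rightarrow> bool" where
  "typical b \<tau> a w \<longleftrightarrow>
     (\<forall>t\<in>{lev a - 2..lev a + 2}. \<bar>hit_rate b w t - hit_prob t a\<bar> \<le> \<tau>) \<and>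
     (\<Sum>i<b. w i - (lev a - 1)) \<le> 6 * b"

lemma hit_rate_antimono: "s \<le> t \<Longrightarrow> hit_rate b w t \<le> hit_rate b w s"
  unfolding hit_rate_def by (intro divide_right_mono of_nat_mono card_mono) auto

text \<open>Hit rates decrease in the level, so the five levels around \<open>lev a\<close> control all others: at
  levels below (above) the window the rate is too large (small) to match the level of any \<open>c\<close>.\<close>

lemma typical_close:
  assumes "typical b \<tau> a w" "a \<ge> 1" "c \<ge> 1" "\<tau> \<le> 1/64"
    and c: "\<bar>hit_rate b w (lev c) - hit_prob (lev c) c\<bar> \<le> \<tau>"
  shows "\<bar>real a - real c\<bar> \<le> 32 * \<tau> * real c"
proof -
  let ?s = "lev a" and ?t = "lev c"
  have near: "\<bar>hit_rate b w t - hit_prob t a\<bar> \<le> \<tau>" if "t \<in> {?s - 2..?s + 2}" for t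
    using assms(1) that by (auto simp: typical_def)
  note lc = hit_prob_lev[OF assms(3)] two_power_le_of_lev[OF assms(3)]
  note la = two_power_le_of_lev[OF assms(2)] less_two_power_lev[of a]
  consider "?t \<ge> ?s + 2" | "?t + 2 \<le> ?s" | "?t \<in> {?s - 2..?s + 2}" by fastforce
  thus ?thesis
  proof cases
    case 1
    have "real a < real (2 ^ ?s)" using la(3) by (simp only: of_nat_less_iff)
    hence "real a * (1/2) ^ (?s + 2) \<le> 2 ^ ?s * (1/2) ^ (?s + 2)"
      by (intro mult_right_mono) auto
    also have "\<dots> = 1/4" by (simp add: power_add power_one_over power2_eq_square)
    finally have "hit_prob (?s + 2) a \<le> 1/4" using hit_prob_le[of "?s + 2" a] by linarith
    \<comment> \<open>Contradiction: the rate at \<open>lev c\<close> is at most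
      \<open>1/4 + \<tau>\<close> and at least \<open>1/3 - \<tau>\<close>, but
      \<open>2 \<tau> \<le> 1/32\<close>. In the next case the values 4/5 and 3/4 clash in the same
      way.\<close>
    with near[of "?s + 2"] hit_rate_antimono[OF 1, of b w] lc(1) c assms(4) show ?thesis by force
  next
    case 2
    have "2 * 2 ^ (?s - 2) = (2::nat) ^ (?s - 1)"
      using 2 lc(3) by (simp flip: power_Suc add: Suc_diff_Suc numeral_2_eq_2)
    hence "hit_prob (?s - 2) a \<ge> 4/5" using la by (intro hit_prob_two_below) auto
    moreover have "hit_rate b w (?s - 2) \<le> hit_rate b w ?t"
      using 2 by (intro hit_rate_antimono) auto
    ultimately show ?thesis using near[of "?s - 2"] lc(2) c assms(4) by force
  next
    case 3
    show ?thesis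
      by (rule hit_prob_close_imp_close) (use near[OF 3] c assms in auto)
  qed
qed

section \<open>Cutoffs, truncated sketches and merging\<close>

definition cutoff :: "nat \<Rightarrow> (nat \<Rightarrow> nat) \<Rightarrow> nat" where
  "cutoff b w = (LEAST q. (\<Sum>i<b. w i - q) \<le> 6 * b)"

lemma cutoff_le: "(\<Sum>i<b. w i - q) \<le> 6 * b \<Longrightarrow> cutoff b w \<le> q"
  unfolding cutoff_def by (rule Least_le)

lemma cutoff_le_bound: "(\<And>i. i < b \<Longrightarrow> w i \<le> N) \<Longrightarrow> cutoff b w \<le> N"
  by (rule cutoff_le) simp

lemma sum_cutoff: "(\<Sum>i<b. w i - cutoff b w) \<le> 6 * b"
  unfolding cutoff_def
\<comment> \<open>The sum of all values is an admissible cutoff: it makes every truncated difference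
  zero.\<close>
proof (rule LeastI[of _ "\<Sum>i<b. w i"])
  have "w i \<le> (\<Sum>i<b. w i)" if "i < b" for i using that by (intro member_le_sum) auto
  thus "(\<Sum>i<b. w i - (\<Sum>i<b. w i)) \<le> 6 * b" by simp
qed

lemma cutoff_mono:
  assumes "\<And>i. i < b \<Longrightarrow> w i \<le> w' i"
  shows "cutoff b w \<le> cutoff b w'"
proof (rule cutoff_le)
  have "(\<Sum>i<b. w i - cutoff b w') \<le> (\<Sum>i<b. w' i - cutoff b w')"
    using assms by (intro sum_mono diff_le_mono) auto
  also have "\<dots> \<le> 6 * b" by (rule sum_cutoff)
  finally show "(\<Sum>i<b. w i - cutoff b w') \<le> 6 * b" .
qed

type_synonym sketch = "nat \<times> nat \<times> nat list"

text \<open>The grid position \<open>u\<close> comes from the seed and is stored because the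
  estimate sees only the sketch.\<close>

definition compress :: "nat \<Rightarrow> nat \<Rightarrow> (nat \<Rightarrow> nat) \<Rightarrow> sketch" where
  "compress b u w = (u, cutoff b w, map (\<lambda>i. w i - cutoff b w) [0..<b])"

fun row_values :: "sketch \<Rightarrow> nat \<Rightarrow> nat" where
  "row_values (u, q, v) i = v ! i + q"

definition merge_sketch :: "nat \<Rightarrow> sketch \<Rightarrow> sketch \<Rightarrow> sketch" where
  "merge_sketch b s t = compress b (fst s) (\<lambda>i. max (row_values s i) (row_values t i))"

lemma row_values_compress: "i < b \<Longrightarrow> row_values (compress b u w) i = max (w i) (cutoff b w)"
  by (simp add: compress_def)

text \<open>Truncated differences at the cutoff ignore any raising of values to a level not above
  it.\<close>

lemma compress_raise:
  assumes "\<And>i. i < b \<Longrightarrow> W i = max (w i) q" "q \<le> cutoff b w"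
  shows "compress b u W = compress b u w"
proof -
  have eq: "W i - cutoff b w = w i - cutoff b w" if "i < b" for i
    using assms that by auto
  have "cutoff b W = cutoff b w"
  proof (rule antisym)
    show "cutoff b W \<le> cutoff b w"
      using sum_cutoff[of w b] eq by (intro cutoff_le) simp
    show "cutoff b w \<le> cutoff b W" using assms(1) by (intro cutoff_mono) auto
  qed
  thus ?thesis using eq by (simp add: compress_def)
qed

text \<open>A sketch determines its rows up to the maximum with its cutoff. The cutoff of the merged
  rows dominates both old cutoffs by monotonicity, so no information needed for the merged sketch
  was lost.\<close>

lemma merge_compress:
  "merge_sketch b (compress b u w1) (compress b u w2) = compress b u (\<lambda>i. max (w1 i) (w2 i))"
proof -
  have "fst (compress b u w1) = u" by (simp add: compress_def)
  thus ?thesis unfolding merge_sketch_def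
    by (simp, intro compress_raise[where q = "max (cutoff b w1) (cutoff b w2)"])
       (auto simp: row_values_compress max.assoc max.left_commute max.commute intro!: cutoff_mono)
qed

text \<open>Only levels above the cutoff are visible in the sketch, whence the condition on \<open>lev c\<close>. For typical
  rows the true cardinality is a witness, and every witness is close to it.\<close>

definition guess :: "nat \<Rightarrow> real \<Rightarrow> sketch \<Rightarrow> nat" where
  "guess b \<tau> sk = (SOME c. c \<ge> 1 \<and> fst (snd sk) < lev c \<and>
     \<bar>hit_rate b (row_values sk) (lev c) - hit_prob (lev c) c\<bar> \<le> \<tau>)"

lemma guess_compress:
  fixes u :: nat
  assumes "typical b \<tau> a w" "a \<ge> 1" "\<tau> \<le> 1/64"
  defines "c \<equiv> guess b \<tau> (compress b u w)"
  shows "c \<ge> 1" "\<bar>real a - real c\<bar> \<le> 32 * \<tau> * real c"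
proof -
  let ?sk = "compress b u w"
  have q: "fst (snd ?sk) = cutoff b w" by (simp add: compress_def)
  \<comment> \<open>Raising values to the cutoff does not change which rows reach a level strictly
    above it.\<close>
  have rate: "hit_rate b (row_values ?sk) t = hit_rate b w t" if "t > cutoff b w" for t
    unfolding hit_rate_def using that
    by (intro arg_cong2[of _ _ _ _ "(/)"] arg_cong[of _ _ "\<lambda>X. real (card X)"] refl)
       (auto simp: row_values_compress)
  have "cutoff b w \<le> lev a - 1" using assms(1) by (intro cutoff_le) (auto simp: typical_def)
  hence cut: "cutoff b w < lev a" using two_power_le_of_lev(1)[OF assms(2)] by linarith
  have "\<exists>c\<ge>1. fst (snd ?sk) < lev c \<and>
     \<bar>hit_rate b (row_values ?sk) (lev c) - hit_prob (lev c) c\<bar> \<le> \<tau>"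
    using assms(1,2) cut by (intro exI[of _ a]) (auto simp: q rate typical_def)
  from someI_ex[OF this] have c: "c \<ge> 1" "cutoff b w < lev c"
     "\<bar>hit_rate b (row_values ?sk) (lev c) - hit_prob (lev c) c\<bar> \<le> \<tau>"
    unfolding c_def guess_def by (auto simp: q)
  show "c \<ge> 1" by fact
  show "\<bar>real a - real c\<bar> \<le> 32 * \<tau> * real c"
    using c assms rate[OF c(2)] by (intro typical_close[OF assms(1,2) c(1)]) auto
qed

text \<open>The interval of half-width \<open>L \<epsilon> c / 2\<close> around \<open>c\<close>
  splits into \<open>L\<close> intervals of length \<open>\<epsilon> c\<close>, and the grid points
  are their midpoints.\<close>

lemma grid_point_near:
  fixes a c \<epsilon> :: real and L :: nat
  assumes "c > 0" "\<epsilon> > 0" "L \<ge> 1" "\<bar>a - c\<bar> \<le> real L * \<epsilon> / 2 * c"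
  shows "\<exists>u<L. \<bar>c * (1 + (2 * real u + 1 - real L) * \<epsilon> / 2) - a\<bar> \<le> \<epsilon> / 2 * c"
proof -
  define y where "y = (a - c) / (c * \<epsilon> / 2)"
  have a: "a = c * (1 + y * \<epsilon> / 2)" using assms by (simp add: y_def field_simps)
  have "\<bar>y\<bar> = \<bar>a - c\<bar> / (c * \<epsilon> / 2)" unfolding y_def abs_divide using assms by simp
  also have "\<dots> \<le> real L" using assms by (simp add: pos_divide_le_eq mult_ac)
  finally have y: "- real L \<le> y" "y \<le> real L" by auto
  \<comment> \<open>The minimum handles the right endpoint \<open>y = L\<close>, where the floor
    would be \<open>L\<close>.\<close>
  define u where "u = min (L - 1) (nat \<lfloor>(y + real L) / 2\<rfloor>)"
  define f where "f = real_of_int \<lfloor>(y + real L) / 2\<rfloor>"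
  have f: "f \<le> (y + real L) / 2" "(y + real L) / 2 < f + 1" unfolding f_def by linarith+
  have nat_f: "real (nat \<lfloor>(y + real L) / 2\<rfloor>) = f" using y by (simp add: f_def)
  have "real (L - 1) = real L - 1" using assms(3) by simp
  hence "real u = min (real L - 1) f" unfolding u_def by (simp add: of_nat_min nat_f)
  hence "\<bar>2 * real u + 1 - real L - y\<bar> \<le> 1" using f y by (simp add: abs_le_iff min_def)
  hence "\<bar>2 * real u + 1 - real L - y\<bar> * (c * \<epsilon> / 2) \<le> 1 * (c * \<epsilon> / 2)"
    using assms by (intro mult_right_mono) auto
  also have "\<bar>2 * real u + 1 - real L - y\<bar> * (c * \<epsilon> / 2)
      = \<bar>(2 * real u + 1 - real L - y) * (c * \<epsilon> / 2)\<bar>"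
    using assms by (simp add: abs_mult)
  also have "(2 * real u + 1 - real L - y) * (c * \<epsilon> / 2)
      = c * (1 + (2 * real u + 1 - real L) * \<epsilon> / 2) - a"
    unfolding a by (simp add: field_simps)
  finally have "\<bar>c * (1 + (2 * real u + 1 - real L) * \<epsilon> / 2) - a\<bar> \<le> \<epsilon> / 2 * c" by (simp add: mult.commute)
  moreover have "u < L" using assms by (auto simp: u_def)
  ultimately show ?thesis by blast
qed

definition estimate_sketch :: "nat \<Rightarrow> nat \<Rightarrow> real \<Rightarrow> sketch \<Rightarrow> real" where
  "estimate_sketch b L \<epsilon> sk = real (guess b (real L * \<epsilon> / 64) sk) *
     (1 + (2 * real (fst sk) + 1 - real L) * \<epsilon> / 2)"

text \<open>The guess \<open>c\<close> is the same for all \<open>u\<close>. The tolerance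
  \<open>L \<epsilon> / 64\<close> makes \<open>32 \<tau>\<close> equal to the relative half-width
  \<open>L \<epsilon> / 2\<close> of the grid, so some grid point is within
  \<open>\<epsilon> c / 2\<close> of \<open>a\<close>; finally \<open>c \<le> 2 a\<close> because
  \<open>L \<epsilon> \<le> 1\<close>.\<close>

lemma estimate_compress:
  assumes "typical b (real L * \<epsilon> / 64) a w" "a \<ge> 1" "L \<ge> 1" "\<epsilon> > 0" "real L * \<epsilon> \<le> 1"
  shows "\<exists>u<L. \<bar>estimate_sketch b L \<epsilon> (compress b u w) - real a\<bar> \<le> \<epsilon> * real a"
proof -
  let ?\<tau> = "real L * \<epsilon> / 64"
  define c where "c = guess b ?\<tau> (compress b 0 w)"
  have c_u: "guess b ?\<tau> (compress b u w) = c" for u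
  proof -
    have "row_values (compress b u w) = row_values (compress b 0 w)"
      by (auto simp: compress_def)
    moreover have "fst (snd (compress b u w)) = fst (snd (compress b 0 w))" by (simp add: compress_def)
    ultimately show ?thesis by (simp add: c_def guess_def)
  qed
  have c: "c \<ge> 1" "\<bar>real a - real c\<bar> \<le> 32 * ?\<tau> * real c"
    unfolding c_def using guess_compress[of b ?\<tau> a w 0] assms by auto
  have c': "\<bar>real a - real c\<bar> \<le> real L * \<epsilon> / 2 * real c" using c(2) by (simp add: mult_ac)
  obtain u where u: "u < L" "\<bar>real c * (1 + (2 * real u + 1 - real L) * \<epsilon> / 2) - real a\<bar> \<le> \<epsilon> / 2 * real c"
    using grid_point_near[OF _ assms(4,3) c'] c(1) by auto
  have "32 * ?\<tau> * real c \<le> 1 / 2 * real c" using assms by (intro mult_right_mono) (auto simp: mult.commute)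
  hence "real c \<le> 2 * real a" using c(2) by linarith
  hence "\<epsilon> / 2 * real c \<le> \<epsilon> / 2 * (2 * real a)" using assms by (intro mult_left_mono) auto
  hence "\<bar>estimate_sketch b L \<epsilon> (compress b u w) - real a\<bar> \<le> \<epsilon> * real a"
    using u by (simp add: estimate_sketch_def c_u) (simp add: compress_def)
  thus ?thesis using u(1) by blast
qed

section \<open>Encoding sketches as bit strings\<close>

definition unary :: "nat \<Rightarrow> bool list" where
  "unary k = replicate k True @ [False]"

lemma unary_append_inject: "unary k @ xs = unary l @ ys \<longleftrightarrow> k = l \<and> xs = ys"
proof (induction k arbitrary: l)
  case 0 show ?case by (cases l) (auto simp: unary_def)
next
  case (Suc k) thus ?case by (cases l) (auto simp: unary_def)
qed

lemma concat_unary_append_inject: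
  "length v = length w \<Longrightarrow> concat (map unary v) @ xs = concat (map unary w) @ ys \<longleftrightarrow> v = w \<and> xs = ys"
  by (induction v w rule: list_induct2) (auto simp: unary_append_inject)

fun binary :: "nat \<Rightarrow> bool list" where
  "binary u = (if u = 0 then [] else odd u # binary (u div 2))"

declare binary.simps [simp del]

lemma binary_inject: "binary u = binary v \<Longrightarrow> u = v"
proof (induction u arbitrary: v rule: less_induct)
  case (less u)
  show ?case
  proof (cases "u = 0 \<or> v = 0")
    case True
    thus ?thesis using less.prems by (auto simp: binary.simps split: if_splits)
  next
    case False
    hence "odd u = odd v" "binary (u div 2) = binary (v div 2)"
      using less.prems by (auto simp: binary.simps[of u] binary.simps[of v])
    moreover have "u div 2 < u" using False by auto
    ultimately have "odd u = odd v" "u div 2 = v div 2" using less.IH by auto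
    thus ?thesis by presburger
  qed
qed

lemma two_power_length_binary: "u > 0 \<Longrightarrow> 2 ^ length (binary u) \<le> 2 * u"
proof (induction u rule: less_induct)
  case (less u)
  have *: "length (binary u) = Suc (length (binary (u div 2)))"
    using less.prems by (simp add: binary.simps[of u])
  show ?case
  proof (cases "u = 1")
    case True
    thus ?thesis unfolding * by (simp add: binary.simps)
  next
    case False
    hence "u div 2 < u" "u div 2 > 0" using less.prems by auto
    from less.IH[OF this] show ?thesis unfolding * by simp
  qed
qed

text \<open>The binary part comes last and needs no delimiter; a unary \<open>u\<close> would cost up to \<open>L\<close>, of order \<open>n\<close>, bits.\<close>

fun encode :: "sketch \<Rightarrow> bool list" where
  "encode (u, q, v) = unary q @ concat (map unary v) @ binary u"

lemma inj_on_encode: "inj_on encode {sk. length (snd (snd sk)) = b}"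
proof (rule inj_onI)
  fix sk sk' assume *: "sk \<in> {sk. length (snd (snd sk)) = b}" "sk' \<in> {sk. length (snd (snd sk)) = b}"
    "encode sk = encode sk'"
  obtain u q v u' q' v' where sk: "sk = (u, q, v)" "sk' = (u', q', v')" by (metis prod.collapse)
  have "length v = length v'" using * sk by simp
  hence "q = q' \<and> v = v' \<and> binary u = binary u'"
    using *(3) by (simp add: sk unary_append_inject concat_unary_append_inject)
  thus "sk = sk'" using binary_inject sk by blast
qed

text \<open>The differences cost their sum, at most \<open>6 b\<close>, plus \<open>b\<close>
  terminators. This holds for all rows, typical or not, as the space usage is a maximum over
  seeds.\<close>

lemma length_encode_compress:
  assumes "\<And>i. i < b \<Longrightarrow> w i \<le> N"
  shows "length (encode (compress b u w)) \<le> N + 1 + 7 * b + length (binary u)"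
proof -
  have "length (concat (map (unary \<circ> f) xs)) = sum_list (map f xs) + length xs"
    for f :: "nat \<Rightarrow> nat" and xs
    by (induction xs) (auto simp: unary_def)
  hence "length (encode (compress b u w))
     = cutoff b w + 1 + (\<Sum>i<b. w i - cutoff b w) + b + length (binary u)"
    by (simp add: compress_def unary_def interv_sum_list_conv_sum_set_nat atLeast0LessThan)
  thus ?thesis using sum_cutoff[of w b] cutoff_le_bound[of b w N, OF assms] by simp
qed

section \<open>Choosing the seeds\<close>

text \<open>A union bound: five two-sided Hoeffding bounds contribute 10 and the excess event
  contributes 1, since \<open>2 \<tau>^2 \<le> 1\<close>. The bound on \<open>N\<close> keeps the
  whole window within the cap.\<close>

lemma prob_atypical:
  assumes "A \<subseteq> {..<n}" "A \<noteq> {}" "b > 0" "0 \<le> \<tau>" "\<tau> \<le> 1/64" "lev (card A) + 2 \<le> N"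
  shows "measure_pmf.prob (rows_pmf n b)
     {H. \<not> typical b \<tau> (card A) (\<lambda>i. row_max N (H i) A)} \<le> 11 * exp (-2 * real b * \<tau>\<^sup>2)"
proof -
  let ?s = "lev (card A)" and ?e = "exp (-2 * real b * \<tau>\<^sup>2)"
  define D where "D t = {H. \<bar>hit_rate b (\<lambda>i. row_max N (H i) A) t - hit_prob t (card A)\<bar> \<ge> \<tau>}" for t
  define E where "E = {H. (\<Sum>i<b. row_max N (H i) A - (?s - 1)) > 6 * b}"
  have D: "measure_pmf.prob (rows_pmf n b) (D t) \<le> 2 * ?e" if "t \<in> {?s - 2..?s + 2}" for t
  proof -
    have "measure_pmf.prob (row_pmf n) {h. t \<le> row_max N h A} = hit_prob t (card A)"
      using that assms by (intro prob_row_max_ge) auto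
    thus ?thesis
      using Pi_pmf_count_deviation[OF assms(3,4), of "\<lambda>_. 0" "row_pmf n" "\<lambda>h. t \<le> row_max N h A"]
      by (simp add: D_def rows_pmf_def hit_rate_def)
  qed
  have "\<tau>\<^sup>2 \<le> (1/64)\<^sup>2" using assms by (intro power_mono) auto
  hence "real b * (2 * \<tau>\<^sup>2) \<le> real b * 1" by (intro mult_left_mono) (auto simp: power_divide)
  hence "exp (- real b) \<le> ?e" by simp
  hence E: "measure_pmf.prob (rows_pmf n b) E \<le> ?e"
    unfolding E_def by (rule order.trans[OF prob_total_excess[OF assms(1,2)]])
  have "measure_pmf.prob (rows_pmf n b) {H. \<not> typical b \<tau> (card A) (\<lambda>i. row_max N (H i) A)}
      \<le> measure_pmf.prob (rows_pmf n b) ((\<Union>t\<in>{?s - 2..?s + 2}. D t) \<union> E)"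
    by (intro measure_pmf.finite_measure_mono) (auto simp: typical_def D_def E_def not_le)
  also have "\<dots> \<le> measure_pmf.prob (rows_pmf n b) (\<Union>t\<in>{?s - 2..?s + 2}. D t) + measure_pmf.prob (rows_pmf n b) E"
    by (intro measure_Un_le) auto
  also have "measure_pmf.prob (rows_pmf n b) (\<Union>t\<in>{?s - 2..?s + 2}. D t)
      \<le> (\<Sum>t\<in>{?s - 2..?s + 2}. measure_pmf.prob (rows_pmf n b) (D t))"
    by (intro measure_pmf.finite_measure_subadditive_finite) auto
  also have "\<dots> \<le> real (card {?s - 2..?s + 2}) * (2 * ?e)"
    using D by (intro sum_bounded_above) auto
  also have "\<dots> \<le> 5 * (2 * ?e)" by (intro mult_right_mono) auto
  finally show ?thesis using E by simp
qed

text \<open>Among \<open>m\<close> independent samples, the bad fraction for a fixed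
  \<open>i\<close> exceeds \<open>\<delta>\<close> with probability at most
  \<open>exp (- m \<delta>^2 / 2) \<le> exp (- 2 n)\<close>. As
  \<open>2^n * exp (- 2 n) < 1\<close>, some sample serves all \<open>i\<close> at once.\<close>

lemma exists_seed_sample:
  assumes "finite I" "card I \<le> 2 ^ n" "n \<ge> 1" "m > 0" "\<delta> > 0"
    and "4 * real n \<le> real m * \<delta>\<^sup>2"
    and "\<And>i. i \<in> I \<Longrightarrow> measure_pmf.prob p {x. bad i x} \<le> \<delta> / 2"
  shows "\<exists>f::nat \<Rightarrow> 'a. \<forall>i\<in>I. real (card {j\<in>{..<m}. bad i (f j)}) \<le> \<delta> * real m"
proof -
  let ?M = "Pi_pmf {..<m} undefined (\<lambda>_. p)"
  let ?E = "\<lambda>i. {f. real (card {j\<in>{..<m}. bad i (f j)}) > \<delta> * real m}"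
  have "measure_pmf.prob ?M (\<Union>i\<in>I. ?E i) \<le> (\<Sum>i\<in>I. measure_pmf.prob ?M (?E i))"
    using assms(1) by (intro measure_pmf.finite_measure_subadditive_finite) auto
  also have "\<dots> \<le> real (card I) * exp (-2 * real m * (\<delta> / 2)\<^sup>2)"
    using assms by (intro sum_bounded_above Pi_pmf_count_excess) force+
  also have "\<dots> \<le> 2 ^ n * exp (- (2 * real n))"
    using assms by (intro mult_mono) (auto simp: power_divide simp flip: of_nat_power_eq_of_nat_cancel_iff)
  also have "\<dots> = (2 * exp (-2)) ^ n"
    by (simp add: power_mult_distrib exp_of_nat_mult[symmetric] mult.commute)
  also have "\<dots> < 1"
  proof -
    have "exp (-2) * 2 < (1::real)"
      using exp_ge_add_one_self[of "2::real"] by (simp add: exp_minus field_simps)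
    thus ?thesis using assms(3) by (intro power_less_one_iff[THEN iffD2]) (auto simp: mult.commute)
  qed
  finally have "(\<Union>i\<in>I. ?E i) \<noteq> UNIV" by (auto simp: measure_pmf.prob_space)
  then obtain f where "f \<notin> (\<Union>i\<in>I. ?E i)" by blast
  thus ?thesis by (intro exI[of _ f]) (auto simp: not_less)
qed

lemma length_binary_le:
  assumes "u < L"
  shows "real (length (binary u)) \<le> log 2 (real L) + 1"
proof (cases "u = 0")
  case False
  have "(2::nat) ^ length (binary u) \<le> 2 * u" using False by (intro two_power_length_binary) auto
  hence "real (2 ^ length (binary u)) \<le> real (2 * L)" using assms by linarith
  hence "real (length (binary u)) \<le> log 2 (2 * real L)"
    using assms by (subst le_log_iff) (auto simp: powr_realpow)
  thus ?thesis using assms by (simp add: log_mult)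
qed (use assms in \<open>auto simp: binary.simps\<close>)

text \<open>At least a fraction \<open>1 - \<delta>'\<close> of the \<open>m\<close> sampled row
  families is typical for \<open>A\<close>, and each of these has a correct grid position among
  \<open>L\<close>, so a seed succeeds with probability at least
  \<open>(1 - \<delta>') / L\<close>.\<close>

lemma mergeable_ce_exists:
  fixes n b L m :: nat and \<epsilon> \<delta> \<delta>' :: real
  assumes n: "n \<ge> 1" and \<epsilon>: "\<epsilon> > 0" and L: "L \<ge> 1" "real L * \<epsilon> \<le> 1" and b: "b > 0" and m: "m > 0"
    and \<delta>': "\<delta>' > 0" "4 * real n \<le> real m * \<delta>'\<^sup>2"
    and tail: "11 * exp (-2 * real b * (real L * \<epsilon> / 64)\<^sup>2) \<le> \<delta>' / 2"
    and \<delta>: "1 - (1 - \<delta>') / real L \<le> \<delta>"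
  shows "\<exists>(\<Theta>::nat set) (S::bool list set) enc single merge estimate \<nu>.
     mergeable_ce n \<epsilon> \<delta> \<Theta> S enc single merge estimate \<nu> \<and>
     space_usage n \<Theta> enc \<nu> \<le> log 2 (real m) + 2 * log 2 (real L) + real (lev n) + 7 * real b + 5"
proof -
  define N where "N = lev n + 2"
  define \<tau> where "\<tau> = real L * \<epsilon> / 64"
  let ?I = "{A. nonempty_sub n A}"
  let ?w = "\<lambda>H A i. row_max N (H i) A"
  have I: "finite A" "A \<noteq> {}" "A \<subseteq> {..<n}" "card A \<ge> 1" "card A \<le> n" if "nonempty_sub n A" for A
  proof -
    show A: "A \<noteq> {}" "A \<subseteq> {..<n}" using that by (auto simp: nonempty_sub_def)
    show "finite A" using A(2) finite_subset by blast
    with A show "card A \<ge> 1" by (simp add: card_gt_0_iff Suc_le_eq)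
    show "card A \<le> n" using card_mono[OF _ A(2)] by simp
  qed
  have sub: "?I \<subseteq> Pow {..<n}" by (auto simp: nonempty_sub_def)
  have "card ?I \<le> card (Pow {..<n})" by (rule card_mono[OF _ sub]) simp
  hence cardI: "card ?I \<le> 2 ^ n" by (simp add: card_Pow)
  have finI: "finite ?I" using sub finite_subset by blast
  have atyp: "measure_pmf.prob (rows_pmf n b) {H. \<not> typical b \<tau> (card A) (?w H A)} \<le> \<delta>' / 2"
    if "A \<in> ?I" for A
  proof -
    have "lev (card A) + 2 \<le> N" using I(5)[of A] that lev_mono by (auto simp: N_def)
    hence "measure_pmf.prob (rows_pmf n b) {H. \<not> typical b \<tau> (card A) (?w H A)}
        \<le> 11 * exp (-2 * real b * \<tau>\<^sup>2)"
      using that I[of A] b \<epsilon> L by (intro prob_atypical) (auto simp: \<tau>_def)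
    thus ?thesis using tail by (simp add: \<tau>_def)
  qed
  obtain F where F: "\<And>A. nonempty_sub n A \<Longrightarrow>
      real (card {j\<in>{..<m}. \<not> typical b \<tau> (card A) (?w (F j) A)}) \<le> \<delta>' * real m"
    using exists_seed_sample[OF finI cardI n m \<delta>',
        where p = "rows_pmf n b" and bad = "\<lambda>A H. \<not> typical b \<tau> (card A) (?w H A)"] atyp
    by blast
  \<comment> \<open>A seed below \<open>m * L\<close> is a pair: sample index
    \<open>\<theta> div L\<close> and grid position \<open>\<theta> mod L\<close>.\<close>
  define sk where "sk \<theta> A = compress b (\<theta> mod L) (?w (F (\<theta> div L)) A)" for \<theta> A
  let ?V = "{sk. length (snd (snd sk)) = b}"
  \<comment> \<open>Sketches are represented by their bit strings, with \<open>id\<close> as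
    encoding; merging and estimating decode first.\<close>
  define dec where "dec = inv_into ?V encode"
  have dec: "dec (encode (sk \<theta> A)) = sk \<theta> A" for \<theta> A
    unfolding dec_def by (intro inv_into_f_f inj_on_encode) (auto simp: sk_def compress_def)
  define \<nu> where "\<nu> \<theta> A = encode (sk \<theta> A)" for \<theta> A
  define merge where "merge x y = encode (merge_sketch b (dec x) (dec y))" for x y
  define estimate where "estimate x = estimate_sketch b L \<epsilon> (dec x)" for x
  define \<Theta> where "\<Theta> = {..<m * L}"
  have card\<Theta>: "card \<Theta> = m * L" "finite \<Theta>" by (auto simp: \<Theta>_def)
  have merge: "merge (\<nu> \<theta> A) (\<nu> \<theta> B) = \<nu> \<theta> (A \<union> B)"
    if "nonempty_sub n A" "nonempty_sub n B" for \<theta> A B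
    using I(1,2)[OF that(1)] I(1,2)[OF that(2)]
    by (simp add: merge_def \<nu>_def dec) (simp add: sk_def merge_compress row_max_Un)
  have accurate: "real (card {\<theta>\<in>\<Theta>. \<bar>estimate (\<nu> \<theta> A) - real (card A)\<bar> > \<epsilon> * real (card A)})
       / real (card \<Theta>) \<le> \<delta>" if A: "nonempty_sub n A" for A
  proof -
    define good where "good = {\<theta>\<in>\<Theta>. \<bar>estimate (\<nu> \<theta> A) - real (card A)\<bar> \<le> \<epsilon> * real (card A)}"
    define bad where "bad = {\<theta>\<in>\<Theta>. \<bar>estimate (\<nu> \<theta> A) - real (card A)\<bar> > \<epsilon> * real (card A)}"
    define T where "T = {j\<in>{..<m}. typical b \<tau> (card A) (?w (F j) A)}"
    have "\<exists>u<L. \<bar>estimate_sketch b L \<epsilon> (compress b u (?w (F j) A)) - real (card A)\<bar> \<le> \<epsilon> * real (card A)"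
      if "j \<in> T" for j
      using that I(4)[OF A] L \<epsilon> by (intro estimate_compress) (auto simp: T_def \<tau>_def)
    then obtain u where u: "\<And>j. j \<in> T \<Longrightarrow> u j < L"
      "\<And>j. j \<in> T \<Longrightarrow> \<bar>estimate_sketch b L \<epsilon> (compress b (u j) (?w (F j) A)) - real (card A)\<bar> \<le> \<epsilon> * real (card A)"
      by metis
    \<comment> \<open>Each typical sample index \<open>j\<close> supplies its own good seed
      \<open>j * L + u j\<close>.\<close>
    have "card T \<le> card good"
    proof (rule card_inj_on_le)
      show "inj_on (\<lambda>j. j * L + u j) T"
      proof (rule inj_onI)
        fix i j assume "i \<in> T" "j \<in> T" "i * L + u i = j * L + u j"
        hence "(i * L + u i) div L = (j * L + u j) div L" by simp
        thus "i = j" using u(1)[OF \<open>i \<in> T\<close>] u(1)[OF \<open>j \<in> T\<close>] by simp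
      qed
      show "(\<lambda>j. j * L + u j) ` T \<subseteq> good"
      proof safe
        fix j assume j: "j \<in> T"
        have "j * L + u j < Suc j * L" using u(1)[OF j] by simp
        also have "\<dots> \<le> m * L" using j by (intro mult_right_mono) (auto simp: T_def)
        finally have "j * L + u j \<in> \<Theta>" by (simp add: \<Theta>_def)
        moreover have "(j * L + u j) div L = j" "(j * L + u j) mod L = u j" using u(1)[OF j] by auto
        ultimately show "j * L + u j \<in> good"
          using u(2)[OF j] by (simp add: good_def estimate_def \<nu>_def dec) (simp add: sk_def)
      qed
      show "finite good" using card\<Theta> by (simp add: good_def)
    qed
    moreover have "card good + card bad = m * L"
      unfolding card\<Theta>(1)[symmetric] good_def bad_def using card\<Theta>(2)
      by (subst card_Un_disjoint[symmetric]) (auto intro!: arg_cong[of _ _ card])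
    moreover have "card T + card {j\<in>{..<m}. \<not> typical b \<tau> (card A) (?w (F j) A)} = m"
    proof -
      have "card T + card {j\<in>{..<m}. \<not> typical b \<tau> (card A) (?w (F j) A)}
          = card (T \<union> {j\<in>{..<m}. \<not> typical b \<tau> (card A) (?w (F j) A)})"
        by (rule card_Un_disjoint[symmetric]) (auto simp: T_def)
      also have "T \<union> {j\<in>{..<m}. \<not> typical b \<tau> (card A) (?w (F j) A)} = {..<m}"
        by (auto simp: T_def)
      finally show ?thesis by simp
    qed
    ultimately have "real (card bad) \<le> real (m * L) - real (card T)"
      "real m = real (card T) + real (card {j\<in>{..<m}. \<not> typical b \<tau> (card A) (?w (F j) A)})"
      by linarith+
    hence "real (card bad) \<le> real m * real L - (1 - \<delta>') * real m"
      using F[OF A] by (simp add: algebra_simps)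
    also have "\<dots> = (1 - (1 - \<delta>') / real L) * (real m * real L)" using L by (simp add: field_simps)
    also have "\<dots> \<le> \<delta> * (real m * real L)" using \<delta> by (intro mult_right_mono) auto
    finally show ?thesis using m L by (simp add: bad_def[symmetric] card\<Theta> pos_divide_le_eq)
  qed
  have "0 \<in> \<Theta>" using m L by (simp add: \<Theta>_def)
  hence "\<Theta> \<noteq> {}" by blast
  hence "mergeable_ce n \<epsilon> \<delta> \<Theta> UNIV id (\<lambda>x \<theta>. \<nu> \<theta> {x}) merge estimate \<nu>"
    unfolding mergeable_ce_def using card\<Theta>(2) merge accurate by simp
  moreover have "space_usage n \<Theta> id \<nu> \<le> log 2 (real m) + 2 * log 2 (real L) + real (lev n) + 7 * real b + 5"
  proof -
    let ?X = "{length (id (\<nu> \<theta> A)) | \<theta> A. \<theta> \<in> \<Theta> \<and> nonempty_sub n A}"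
    have "?X = (\<lambda>(\<theta>, A). length (\<nu> \<theta> A)) ` (\<Theta> \<times> ?I)" by auto
    hence fin: "finite ?X" using card\<Theta>(2) finI by simp
    have "0 \<in> \<Theta>" "nonempty_sub n {0}" using m L n by (auto simp: \<Theta>_def nonempty_sub_def)
    hence "?X \<noteq> {}" by blast
    with fin have "Max ?X \<in> ?X" by (rule Max_in)
    then obtain \<theta> A where A: "nonempty_sub n A" "Max ?X = length (\<nu> \<theta> A)" by auto
    have "length (\<nu> \<theta> A) \<le> N + 1 + 7 * b + length (binary (\<theta> mod L))"
      unfolding \<nu>_def sk_def using I(1,2)[OF A(1)] by (intro length_encode_compress row_max_le)
    moreover have "real (length (binary (\<theta> mod L))) \<le> log 2 (real L) + 1"
      using L by (intro length_binary_le) auto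
    ultimately have 1: "real (Max ?X) \<le> real N + 2 + 7 * real b + log 2 (real L)"
      unfolding A(2) by linarith
    have "real_of_int \<lceil>log 2 (real (card \<Theta>))\<rceil> \<le> log 2 (real m * real L) + 1"
      by (simp add: card\<Theta>)
    also have "log 2 (real m * real L) = log 2 (real m) + log 2 (real L)"
      using m L by (simp add: log_mult)
    finally show ?thesis using 1 unfolding space_usage_def by (simp add: N_def)
  qed
  ultimately show ?thesis by blast
qed

section \<open>Choosing the parameters\<close>

definition achieves :: "nat \<Rightarrow> real \<Rightarrow> real \<Rightarrow> real \<Rightarrow> bool" where
  "achieves n \<epsilon> \<delta> B \<longleftrightarrow> (\<exists>(\<Theta>::nat set) (S::bool list set) enc single merge estimate \<nu>.
     mergeable_ce n \<epsilon> \<delta> \<Theta> S enc single merge estimate \<nu> \<and> space_usage n \<Theta> enc \<nu> \<le> B)"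

lemma achieves_mono: "achieves n \<epsilon> \<delta> B \<Longrightarrow> B \<le> B' \<Longrightarrow> achieves n \<epsilon> \<delta> B'"
  unfolding achieves_def by (meson order.trans)

lemma log2_le:
  assumes "x \<ge> 1"
  shows "log 2 x \<le> 2 * ln x"
proof -
  have "ln x * (1/2) \<le> ln x * ln (2::real)"
    using assms ln2_ge_two_thirds by (intro mult_left_mono) auto
  thus ?thesis using ln2_ge_two_thirds by (simp add: log_def pos_divide_le_eq)
qed

lemma lev_le:
  assumes "n \<ge> 1"
  shows "real (lev n) \<le> 2 * ln (real n) + 1"
proof -
  have "real (2 ^ (lev n - 1)) \<le> real n"
    using two_power_le_of_lev(2)[OF assms] by (simp only: of_nat_le_iff)
  hence "real (lev n - 1) \<le> log 2 (real n)"
    using assms by (subst le_log_iff) (auto simp: powr_realpow)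
  also have "\<dots> \<le> 2 * ln (real n)" using assms by (intro log2_le) auto
  finally show ?thesis by linarith
qed

text \<open>Gives \<open>11 * exp (-4) < 1/2\<close>, which absorbs the factor 11 of
  \<open>prob_atypical\<close>.\<close>

lemma exp_4_ge: "exp (4::real) \<ge> 25"
proof -
  have "(5::real)\<^sup>2 \<le> exp 2 ^ 2"
    using exp_lower_Taylor_quadratic[of "2::real"] by (intro power_mono) auto
  thus ?thesis by (simp add: exp_of_nat_mult[symmetric])
qed

lemma achieves_small_delta:
  fixes n :: nat and \<epsilon> \<delta> :: real
  assumes n: "n \<ge> 1" and \<epsilon>: "0 < \<epsilon>" "\<epsilon> < 1" and \<delta>: "0 < \<delta>" "\<delta> \<le> 15/16"
  shows "achieves n \<epsilon> \<delta> (2 ^ 23 * (ln (1 / \<delta>) / \<epsilon>\<^sup>2 + ln (real n) + 1))"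
proof -
  define l where "l = ln (1 / \<delta>)"
  \<comment> \<open>The Hoeffding exponent becomes \<open>2 * 2^18 / 64^2 * l = 128 l\<close>, which
    is at least \<open>l + 4\<close> for \<open>l \<ge> 1/16\<close>.\<close>
  define b where "b = nat \<lceil>2 ^ 18 * l / \<epsilon>\<^sup>2\<rceil>"
  define m where "m = nat \<lceil>4 * real n / \<delta>\<^sup>2\<rceil>"
  have "ln \<delta> \<le> \<delta> - 1" using \<delta> by (intro ln_le_minus_one)
  hence l: "l \<ge> 1/16" using \<delta> by (simp add: l_def ln_div)
  have exp_l: "exp (- l) = \<delta>" using \<delta> by (simp add: l_def ln_div)
  have eps2: "0 < \<epsilon>\<^sup>2" "\<epsilon>\<^sup>2 \<le> 1" using \<epsilon> by (auto simp: power_le_one)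
  have del2: "0 < \<delta>\<^sup>2" "\<delta>\<^sup>2 \<le> 1" using \<delta> by (auto simp: power_le_one)
  have pos: "2 ^ 18 * l / \<epsilon>\<^sup>2 > 0" "4 * real n / \<delta>\<^sup>2 > 0" using l eps2 del2 n by auto
  have b: "2 ^ 18 * l / \<epsilon>\<^sup>2 \<le> real b" "real b \<le> 2 ^ 18 * l / \<epsilon>\<^sup>2 + 1" "b > 0"
    using pos(1) unfolding b_def by linarith+
  have m: "4 * real n / \<delta>\<^sup>2 \<le> real m" "real m \<le> 4 * real n / \<delta>\<^sup>2 + 1" "m > 0"
    using pos(2) unfolding m_def by linarith+
  have "2 ^ 18 * l \<le> real b * \<epsilon>\<^sup>2" using b(1) eps2 by (simp add: pos_divide_le_eq)
  hence "128 * l \<le> 2 * real b * (\<epsilon> / 64)\<^sup>2" by (simp add: power_divide)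
  hence "exp (-2 * real b * (\<epsilon> / 64)\<^sup>2) \<le> exp (- l + - 4)" using l by simp
  also have "\<dots> = \<delta> * exp (- 4)" by (simp only: exp_add exp_l)
  also have "\<dots> \<le> \<delta> * (1 / 25)"
    using exp_4_ge \<delta> by (intro mult_left_mono) (auto simp: exp_minus field_simps)
  finally have tail: "11 * exp (-2 * real b * (real 1 * \<epsilon> / 64)\<^sup>2) \<le> \<delta> / 2" using \<delta> by simp
  have "4 * real n \<le> real m * \<delta>\<^sup>2" using m(1) del2 by (simp add: pos_divide_le_eq)
  hence "achieves n \<epsilon> \<delta> (log 2 (real m) + 2 * log 2 (real 1) + real (lev n) + 7 * real b + 5)"
    unfolding achieves_def using n \<epsilon> b(3) m(3) \<delta> tail
    by (intro mergeable_ce_exists[where \<delta>' = \<delta>]) auto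
  moreover have "log 2 (real m) + 2 * log 2 (real 1) + real (lev n) + 7 * real b + 5
      \<le> 2 ^ 23 * (l / \<epsilon>\<^sup>2 + ln (real n) + 1)"
  proof -
    have ln_n: "ln (real n) \<ge> 0" using n by simp
    have "1 \<le> real n / \<delta>\<^sup>2" using n del2 by (simp add: pos_le_divide_eq)
    hence "real m \<le> 5 * (real n / \<delta>\<^sup>2)" using m(2) by simp
    hence "ln (real m) \<le> ln (5 * (real n / \<delta>\<^sup>2))" using m(3) by (intro ln_mono) auto
    also have "\<dots> = ln 5 + ln (real n) + 2 * l"
      using n \<delta> by (simp add: ln_mult ln_div ln_realpow l_def)
    also have "ln (5::real) \<le> 4" using ln_le_minus_one[of "5::real"] by simp
    finally have "log 2 (real m) \<le> 8 + 2 * ln (real n) + 4 * l"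
      using log2_le[of "real m"] m(3) by simp
    moreover have "l \<le> l / \<epsilon>\<^sup>2" using l eps2 by (simp add: pos_le_divide_eq mult_left_le)
    ultimately show ?thesis using lev_le[OF n] b(2) ln_n l by simp
  qed
  ultimately show ?thesis unfolding l_def[symmetric] by (rule achieves_mono)
qed

text \<open>With \<open>\<delta>' = 1/2\<close> the success probability is at least
  \<open>1 / (2 L)\<close>, which must reach \<open>\<eta> = 1 - \<delta>\<close>;
  \<open>L \<le> 1 / (4 sqrt \<eta>)\<close> suffices. The lower bound on \<open>\<epsilon>\<close>
  keeps \<open>log L\<close> of order \<open>ln n + 1\<close>.\<close>

lemma achieves_large_delta:
  fixes n :: nat and \<epsilon> \<delta> :: real
  assumes n: "n \<ge> 1" and \<epsilon>: "1 / (3 * real n) \<le> \<epsilon>" "\<epsilon> < 1" and \<delta>: "15/16 < \<delta>" "\<delta> < 1"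
  shows "achieves n \<epsilon> \<delta> (2 ^ 23 * (ln (1 / \<delta>) / \<epsilon>\<^sup>2 + ln (real n) + 1))"
proof -
  define \<eta> where "\<eta> = 1 - \<delta>"
  define r where "r = sqrt \<eta>"
  define x where "x = min (1 / (4 * r)) (1 / \<epsilon>)"
  define L where "L = nat \<lfloor>x\<rfloor>"
  \<comment> \<open>Here \<open>2 * 2^14 / 64^2 = 8\<close> gives a Hoeffding factor of at most
    \<open>exp (-8)\<close>; \<open>m\<close> meets \<open>4 n \<le> m (1/2)^2\<close> with
    equality.\<close>
  define b where "b = nat \<lceil>2 ^ 14 / (real L * \<epsilon>)\<^sup>2\<rceil>"
  define m where "m = 16 * n"
  have "0 < 1 / (3 * real n)" using n by simp
  hence \<epsilon>0: "\<epsilon> > 0" using \<epsilon> by linarith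
  have \<eta>: "0 < \<eta>" "\<eta> < 1/16" using \<delta> by (auto simp: \<eta>_def)
  have r: "0 < r" "r < 1/4" "r\<^sup>2 = \<eta>"
    using \<eta> real_less_lsqrt[of "1/4" \<eta>] by (auto simp: r_def power_divide)
  have x1: "x \<ge> 1" using r \<epsilon> \<epsilon>0 by (simp add: x_def)
  have L: "real L \<le> x" "x < real L + 1" "L \<ge> 1" using x1 unfolding L_def by linarith+
  have L': "x \<le> 2 * real L" using L by linarith
  have "real L \<le> 1 / (4 * r)" "real L \<le> 1 / \<epsilon>" using L(1) by (auto simp: x_def)
  hence Lr: "4 * r * real L \<le> 1" and L\<epsilon>: "real L * \<epsilon> \<le> 1"
    using r \<epsilon>0 by (auto simp: pos_le_divide_eq mult_ac)
  have "r * r \<le> r * 1" using r by (intro mult_left_mono) auto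
  hence "\<eta> * real L \<le> r * real L" using r by (intro mult_right_mono) (auto simp: power2_eq_square)
  hence "\<eta> * real L \<le> 1/2" using Lr by simp
  hence succ: "1 - (1 - 1/2) / real L \<le> \<delta>" using L(3) by (simp add: \<eta>_def field_simps)
  let ?y = "(real L * \<epsilon>)\<^sup>2"
  have y: "?y > 0" using L(3) \<epsilon>0 by simp
  hence "2 ^ 14 / ?y > 0" by simp
  hence b: "2 ^ 14 / ?y \<le> real b" "real b \<le> 2 ^ 14 / ?y + 1" "b > 0"
    unfolding b_def by linarith+
  have "2 ^ 14 \<le> real b * ?y" using b(1) y by (simp add: pos_divide_le_eq)
  hence "8 \<le> 2 * real b * (real L * \<epsilon> / 64)\<^sup>2" by (simp add: power_divide)
  hence "exp (-2 * real b * (real L * \<epsilon> / 64)\<^sup>2) \<le> exp (- 4 + - 4)" by simp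
  also have "\<dots> = exp (- 4) * exp (- 4)" by (simp only: exp_add)
  also have "\<dots> \<le> 1 / 25 * (1 / 25)"
    using exp_4_ge by (intro mult_mono) (auto simp: exp_minus field_simps)
  finally have tail: "11 * exp (-2 * real b * (real L * \<epsilon> / 64)\<^sup>2) \<le> (1/2) / 2" by simp
  have "4 * real n \<le> real m * (1/2)\<^sup>2" by (simp add: m_def power_divide)
  hence "achieves n \<epsilon> \<delta> (log 2 (real m) + 2 * log 2 (real L) + real (lev n) + 7 * real b + 5)"
    unfolding achieves_def using n \<epsilon>0 b(3) L(3) L\<epsilon> tail succ
    by (intro mergeable_ce_exists[where \<delta>' = "1/2"]) (auto simp: m_def)
  moreover have "log 2 (real m) + 2 * log 2 (real L) + real (lev n) + 7 * real b + 5
      \<le> 2 ^ 23 * (ln (1 / \<delta>) / \<epsilon>\<^sup>2 + ln (real n) + 1)"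
  proof -
    have ln_n: "ln (real n) \<ge> 0" using n by simp
    have "ln (real m) = ln 16 + ln (real n)" using n by (simp add: m_def ln_mult)
    also have "ln (16::real) \<le> 15" using ln_le_minus_one[of "16::real"] by simp
    finally have 1: "log 2 (real m) \<le> 30 + 2 * ln (real n)"
      using log2_le[of "real m"] n by (simp add: m_def)
    have "1 / \<epsilon> \<le> 3 * real n" using \<epsilon>(1) \<epsilon>0 n by (simp add: field_simps)
    hence "real L \<le> 3 * real n" using \<open>real L \<le> 1 / \<epsilon>\<close> by linarith
    hence "ln (real L) \<le> ln (3 * real n)" using L(3) by (intro ln_mono) auto
    also have "\<dots> = ln 3 + ln (real n)" using n by (simp add: ln_mult)
    also have "ln (3::real) \<le> 2" using ln_le_minus_one[of "3::real"] by simp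
    finally have 2: "log 2 (real L) \<le> 4 + 2 * ln (real n)" using log2_le[of "real L"] L(3) by simp
    \<comment> \<open>This bounds \<open>1 / (L \<epsilon>)^2\<close> by a multiple of
      \<open>\<eta> / \<epsilon>^2 + 1\<close>, with one case for each term of the minimum
      \<open>x\<close>; \<open>x \<le> 2 L\<close> absorbs the rounding of \<open>L\<close>.\<close>
    have "1 \<le> 4 * ?y * (16 * \<eta> / \<epsilon>\<^sup>2 + 1)"
    proof (cases "1 / (4 * r) \<le> 1 / \<epsilon>")
      case True
      have "1 \<le> 4 * r * (2 * real L)" using L' True r by (simp add: x_def min_def field_simps)
      hence "1\<^sup>2 \<le> (4 * r * (2 * real L))\<^sup>2" by (intro power_mono) auto
      also have "\<dots> = 4 * ?y * (16 * \<eta> / \<epsilon>\<^sup>2)" using \<epsilon>0 by (simp add: power_mult_distrib r(3))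
      also have "\<dots> \<le> 4 * ?y * (16 * \<eta> / \<epsilon>\<^sup>2 + 1)" by (intro mult_left_mono) auto
      finally show ?thesis by simp
    next
      case False
      have "1 \<le> 2 * (real L * \<epsilon>)" using L' False \<epsilon>0 by (simp add: x_def min_def field_simps)
      hence "1\<^sup>2 \<le> (2 * (real L * \<epsilon>))\<^sup>2" by (intro power_mono) auto
      also have "\<dots> = 4 * ?y * 1" by (simp add: power_mult_distrib)
      also have "\<dots> \<le> 4 * ?y * (16 * \<eta> / \<epsilon>\<^sup>2 + 1)" using \<eta> by (intro mult_left_mono) auto
      finally show ?thesis by simp
    qed
    hence "1 / ?y \<le> 4 * (16 * \<eta> / \<epsilon>\<^sup>2 + 1)" unfolding pos_divide_le_eq[OF y] by (simp only: mult_ac)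
    hence 3: "real b \<le> 2 ^ 20 * (\<eta> / \<epsilon>\<^sup>2) + 2 ^ 16 + 1" using b(2) by simp
    have "ln \<delta> \<le> \<delta> - 1" using \<delta> by (intro ln_le_minus_one) auto
    hence "\<eta> / \<epsilon>\<^sup>2 \<le> ln (1 / \<delta>) / \<epsilon>\<^sup>2" using \<delta> by (intro divide_right_mono) (auto simp: \<eta>_def ln_div)
    moreover have "\<eta> / \<epsilon>\<^sup>2 \<ge> 0" using \<eta> by simp
    ultimately show ?thesis using lev_le[OF n] 1 2 3 ln_n by simp
  qed
  ultimately show ?thesis by (rule achieves_mono)
qed

text \<open>A relative error of \<open>1/(3n)\<close> is an absolute error below \<open>1/2\<close>, so rounding is exact.\<close>

lemma achieves_exact:
  assumes "achieves n (1 / (3 * real n)) \<delta> B" "n \<ge> 1" "\<epsilon> > 0"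
  shows "achieves n \<epsilon> \<delta> B"
proof -
  obtain \<Theta> :: "nat set" and S :: "bool list set" and enc single merge estimate \<nu> where
    *: "mergeable_ce n (1 / (3 * real n)) \<delta> \<Theta> S enc single merge estimate \<nu>" "space_usage n \<Theta> enc \<nu> \<le> B"
    using assms(1) unfolding achieves_def by blast
  let ?est = "\<lambda>s. real_of_int (round (estimate s))"
  have "real (card {\<theta>\<in>\<Theta>. \<bar>?est (\<nu> \<theta> A) - real (card A)\<bar> > \<epsilon> * real (card A)}) / real (card \<Theta>) \<le> \<delta>"
    if A: "nonempty_sub n A" for A
  proof -
    have "card A \<le> n" using A card_mono[of "{..<n}" A] by (auto simp: nonempty_sub_def)
    hence small: "1 / (3 * real n) * real (card A) \<le> 1/3" using assms(2) by (simp add: field_simps)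
    have "{\<theta>\<in>\<Theta>. \<bar>?est (\<nu> \<theta> A) - real (card A)\<bar> > \<epsilon> * real (card A)}
       \<subseteq> {\<theta>\<in>\<Theta>. \<bar>estimate (\<nu> \<theta> A) - real (card A)\<bar> > 1 / (3 * real n) * real (card A)}"
    proof safe
      fix \<theta> assume far: "\<bar>?est (\<nu> \<theta> A) - real (card A)\<bar> > \<epsilon> * real (card A)"
      show "\<bar>estimate (\<nu> \<theta> A) - real (card A)\<bar> > 1 / (3 * real n) * real (card A)"
      proof (rule ccontr)
        assume "\<not> ?thesis"
        hence "\<bar>estimate (\<nu> \<theta> A) - real_of_int (int (card A))\<bar> < 1/2" using small by simp
        hence "round (estimate (\<nu> \<theta> A)) = int (card A)" by (rule round_unique')
        thus False using far assms(3) by (simp add: mult_less_0_iff)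
      qed
    qed
    hence "real (card {\<theta>\<in>\<Theta>. \<bar>?est (\<nu> \<theta> A) - real (card A)\<bar> > \<epsilon> * real (card A)}) / real (card \<Theta>)
       \<le> real (card {\<theta>\<in>\<Theta>. \<bar>estimate (\<nu> \<theta> A) - real (card A)\<bar> > 1 / (3 * real n) * real (card A)}) / real (card \<Theta>)"
      using *(1) by (intro divide_right_mono of_nat_mono card_mono) (auto simp: mergeable_ce_def)
    also have "\<dots> \<le> \<delta>" using *(1) A by (auto simp: mergeable_ce_def)
    finally show ?thesis .
  qed
  hence "mergeable_ce n \<epsilon> \<delta> \<Theta> S enc single merge ?est \<nu>"
    using *(1) unfolding mergeable_ce_def by blast
  thus ?thesis using *(2) unfolding achieves_def by blast
qed

theorem theorem16:
  shows "\<exists>C>0. \<forall>(n::nat) (\<epsilon>::real) (\<delta>::real). n \<ge> 1 \<and> 0 < \<epsilon> \<and> \<epsilon> < 1 \<and> 0 < \<delta> \<and> \<delta> < 1 \<longrightarrow>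
     (\<exists>(\<Theta>::nat set) (S::bool list set) (enc::bool list \<Rightarrow> bool list)
        (single::nat \<Rightarrow> nat \<Rightarrow> bool list) merge (estimate::bool list \<Rightarrow> real) \<nu>.
        mergeable_ce n \<epsilon> \<delta> \<Theta> S enc single merge estimate \<nu> \<and>
        space_usage n \<Theta> enc \<nu> \<le> C * (ln (1 / \<delta>) / \<epsilon>\<^sup>2 + ln (real n) + 1))"
proof -
  have "achieves n \<epsilon> \<delta> (2 ^ 23 * (ln (1 / \<delta>) / \<epsilon>\<^sup>2 + ln (real n) + 1))"
    if "n \<ge> 1" "0 < \<epsilon>" "\<epsilon> < 1" "0 < \<delta>" "\<delta> < 1" for n \<epsilon> \<delta>
  proof (cases "\<delta> \<le> 15/16 \<or> 1 / (3 * real n) \<le> \<epsilon>")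
    case True
    thus ?thesis using that achieves_small_delta achieves_large_delta by (meson not_le)
  next
    case False
    \<comment> \<open>Here \<open>\<epsilon> < 1 / (3 n)\<close>. The structure for accuracy
      \<open>1 / (3 n)\<close> fits the larger budget for \<open>\<epsilon>\<close>, and rounding
      makes it exact.\<close>
    let ?\<epsilon> = "1 / (3 * real n)"
    have "?\<epsilon> < 1" using that(1) by simp
    hence "achieves n ?\<epsilon> \<delta> (2 ^ 23 * (ln (1 / \<delta>) / ?\<epsilon>\<^sup>2 + ln (real n) + 1))"
      using that False by (intro achieves_large_delta) auto
    hence "achieves n \<epsilon> \<delta> (2 ^ 23 * (ln (1 / \<delta>) / ?\<epsilon>\<^sup>2 + ln (real n) + 1))"
      by (rule achieves_exact) (use that in auto)
    moreover have "ln (1 / \<delta>) / ?\<epsilon>\<^sup>2 \<le> ln (1 / \<delta>) / \<epsilon>\<^sup>2"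
      using that False by (intro divide_left_mono power_mono mult_pos_pos) auto
    ultimately show ?thesis by (elim achieves_mono) simp
  qed
  thus ?thesis unfolding achieves_def by (intro exI[of _ "2 ^ 23"]) simp
qed

end
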